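(* For all integers $0\le r\le m\le n$, $$\bigl|\{\alpha\in\mathrm{UPF}_n : m(\alpha)=m,\ \operatorname{fix}(\alpha)=r\}\bigr| = S(n,m)\binom{m}{r}d_{m-r}.$$
   Context: $[n]=\{1,\dots,n\}$. $S(n,m)$ is the Stirling number of the second kind and $d_k$ is the number of derangements of $[k]$ ($d_0=1$). A tuple $\alpha=(a_1,\dots,a_n)\in[n]^n$ is a parking function if, when cars $1,\dots,n$ enter in this order a one-way street with spots $1,\dots,n$ and car $i$ parks in the first free spot $s_i\ge a_i$, all cars manage to park. $\mathrm{UPF}_n$ (unit-interval parking functions) is the set of parking functions of length $n$ with $s_i-a_i\in\{0,1\}$ for all $i$; $\mathrm{UPF}_0$ consists of the empty tuple. Block structure: for $\alpha\in\mathrm{UPF}_n$ let $(a^\uparrow_1,\dots,a^\uparrow_n)$ be its weakly increasing rearrangement, let $\nu_1<\dots<\nu_m$ be the indices $i$ with $a^\uparrow_i=i$, put $\nu_{m+1}=n+1$, and let $m(\alpha)=m$ be the number of blocks. The car set of block $j$ is $I_j=\{i\in[n]:\nu_j\le a_i<\nu_{j+1}\}$. Set $\phi(\alpha)=(I_1,\dots,I_m)$, an ordered set partition of $[n]$. For an ordered set partition $(C_1,\dots,C_k)$ of $[n]$ whose blocks listed by increasing minimum element are $B_1,\dots,B_k$, the block $C_i$ is fixed if $C_i=B_i$. $\operatorname{fix}(\alpha)$ is the number of fixed blocks of $\phi(\alpha)$. *)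

theory Defs
  imports "HOL-Combinatorics.Stirling" "HOL-Combinatorics.Permutations"
begin

text \<open>
  A tuple \<open>\<alpha> = (a\<^sub>1, \<dots>, a\<^sub>n)\<close> is a list of length \<open>n\<close>. Cars, spots and preferences are numbered
  from \<open>1\<close>, list positions from \<open>0\<close>, so that \<open>a\<^sub>i\<close> is \<open>\<alpha> ! (i - 1)\<close>.
\<close>

text \<open>
  \<open>park F \<alpha>\<close> lets the cars with preferences \<open>\<alpha>\<close> enter in this order when \<open>F\<close> is the (finite) set of
  free spots. The result lists the spots in which they park; it is \<open>None\<close> if some car cannot park.
\<close>

fun park :: "nat set \<Rightarrow> nat list \<Rightarrow> nat list option" where
  "park F [] = Some []"
| "park F (a # as) =
    (if {s \<in> F. a \<le> s} = {} then None
     else let s = Min {s \<in> F. a \<le> s} in map_option (Cons s) (park (F - {s}) as))"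

definition parking_functions :: "nat \<Rightarrow> nat list set" where
  "parking_functions n =
    {\<alpha>. length \<alpha> = n \<and> set \<alpha> \<subseteq> {1..n} \<and> park {1..n} \<alpha> \<noteq> None}"

definition UPF :: "nat \<Rightarrow> nat list set" where
  "UPF n = {\<alpha> \<in> parking_functions n.
    \<forall>i\<in>{1..n}. int (the (park {1..n} \<alpha>) ! (i - 1)) - int (\<alpha> ! (i - 1)) \<in> {0, 1}}"

text \<open>The list \<open>[\<nu>\<^sub>1, \<dots>, \<nu>\<^sub>m]\<close>, without the sentinel \<open>\<nu>\<^bsub>m+1\<^esub> = n + 1\<close>.\<close>

definition block_starts :: "nat list \<Rightarrow> nat list" where
  "block_starts \<alpha> = sorted_list_of_set {i \<in> {1..length \<alpha>}. sort \<alpha> ! (i - 1) = i}"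

definition num_blocks :: "nat list \<Rightarrow> nat" where
  "num_blocks \<alpha> = length (block_starts \<alpha>)"

text \<open>The car set \<open>I\<^sub>j\<close>, for \<open>1 \<le> j \<le> m\<close>.\<close>

definition car_set :: "nat list \<Rightarrow> nat \<Rightarrow> nat set" where
  "car_set \<alpha> j = (let \<nu> = block_starts \<alpha> @ [length \<alpha> + 1] in
    {i \<in> {1..length \<alpha>}. \<nu> ! (j - 1) \<le> \<alpha> ! (i - 1) \<and> \<alpha> ! (i - 1) < \<nu> ! j})"

definition block_partition :: "nat list \<Rightarrow> nat set list" where
  "block_partition \<alpha> = map (car_set \<alpha>) [1..<num_blocks \<alpha> + 1]"

text \<open>
  An ordered set partition is the list of its blocks. The blocks are nonempty and disjoint, so their
  minima are distinct and \<open>sort_key Min\<close> is the listing by increasing minimum.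
\<close>

definition num_fixed_blocks :: "nat set list \<Rightarrow> nat" where
  "num_fixed_blocks Cs = card {i. i < length Cs \<and> Cs ! i = sort_key Min Cs ! i}"

definition fix_blocks :: "nat list \<Rightarrow> nat" where
  "fix_blocks \<alpha> = num_fixed_blocks (block_partition \<alpha>)"

definition derangements :: "nat \<Rightarrow> nat" where
  "derangements k = card {\<pi>. \<pi> permutes {1..k} \<and> (\<forall>i\<in>{1..k}. \<pi> i \<noteq> i)}"

end

theory Submission
  imports Defs
begin

text \<open>
  If every car of a unit interval parking function \<open>\<alpha>\<close> parks in its preferred spot ("lucky") or in the
  next one, then reading the preferences in the order of the spots gives the weakly increasing
  rearrangement of \<open>\<alpha>\<close>. Hence the block starts are the spots of the lucky cars, and each block occupies
  an interval of spots, in which its cars stand in increasing order. So \<open>\<alpha>\<close> is determined by the map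
  \<open>\<beta>\<close> sending a car to the index of its block: car \<open>i\<close> parks in the spot whose number is the rank of
  \<open>(\<beta> i, i)\<close> in the lexicographic order, and it is lucky iff it is the smallest car of its block. Every
  surjection \<open>\<beta>\<close> arises in this way, so \<open>\<phi>\<close> is a bijection onto the ordered set partitions. The
  orderings of a given partition into \<open>m\<close> blocks are the permutations of its standard listing, with
  fixed blocks corresponding to fixed points.
\<close>

section \<open>Set partitions\<close>

text \<open>Meets the disjointness premise of \<open>partition_on_insert\<close> whenever a block is
  split off from its partition.\<close>

lemma disjnt_partition_remainder:
  assumes "partition_on A P" "X \<in> P"
  shows "disjnt X (\<Union>(P - {X}))"
  using partition_onD2[OF assms(1)] assms(2) by (force simp: pairwise_def disjnt_def)

text \<open>Induction along the Stirling recurrence: in a partition of \<open>insert a A\<close>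
  into \<open>Suc l\<close> blocks, either \<open>{a}\<close> is a block and the rest partitions
  \<open>A\<close> into \<open>l\<close> blocks, or \<open>a\<close> has joined one of the
  \<open>Suc l\<close> blocks of a partition of \<open>A\<close>.\<close>

lemma card_partition_on:
  assumes "finite A"
  shows "card {P. partition_on A P \<and> card P = k} = Stirling (card A) k"
  using assms
proof (induction A arbitrary: k rule: finite_induct)
  case empty
  have eq: "{P. partition_on {} P \<and> card P = k} = (if k = 0 then {{}} else {} :: 'a set set set)"
    by (auto simp: partition_on_empty)
  show ?case unfolding eq by (cases k) auto
next
  case (insert a A)
  show ?case
  proof (cases k)
    case 0
    have "card P \<noteq> 0" if "partition_on (insert a A) P" for P
    proof -
      have "finite P" using finite_elements[OF _ that] insert.hyps(1) by simp
      moreover have "P \<noteq> {}" using that by (auto simp: partition_on_def)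
      ultimately show ?thesis by simp
    qed
    then have eq: "{P. partition_on (insert a A) P \<and> card P = k} = {}" using 0 by auto
    show ?thesis unfolding eq using 0 insert.hyps by simp
  next
    case (Suc l)
    define S where "S j = {P. partition_on A P \<and> card P = j}" for j
    define T where "T = {Q. partition_on (insert a A) Q \<and> card Q = Suc l}"
    define T1 where "T1 = {Q \<in> T. {a} \<in> Q}"
    define T2 where "T2 = {Q \<in> T. {a} \<notin> Q}"
    have finS: "finite (S j)" for j
      unfolding S_def by (rule finite_subset[OF _ finitely_many_partition_on[OF insert.hyps(1)]]) auto
    have finT: "finite T"
      unfolding T_def using insert.hyps(1)
      by (intro finite_subset[OF _ finitely_many_partition_on[of "insert a A"]]) auto
    have notin: "a \<notin> X" if "partition_on A P" "X \<in> P" for P X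
      using that insert.hyps(2) by (auto simp: partition_on_def)
    have fin: "finite P" if "partition_on A P" for P
      using finite_elements[OF insert.hyps(1) that] .
    have fin': "finite P" if "partition_on (insert a A) P" for P
      using finite_elements[OF _ that] insert.hyps(1) by simp
    have "bij_betw (insert {a}) (S l) T1"
    proof (rule bij_betw_byWitness[where f' = "\<lambda>Q. Q - {{a}}"])
      show "\<forall>P\<in>S l. insert {a} P - {{a}} = P" using notin unfolding S_def by blast
      show "\<forall>Q\<in>T1. insert {a} (Q - {{a}}) = Q" by (auto simp: T1_def)
      show "insert {a} ` S l \<subseteq> T1"
      proof (rule image_subsetI)
        fix P assume P: "P \<in> S l"
        then have pP: "partition_on A P" and cP: "card P = l" by (auto simp: S_def)
        then have d: "disjnt {a} (\<Union>P)" and "{a} \<notin> P"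
          using notin[OF pP] by (auto simp: disjnt_def)
        moreover have "insert a A - {a} = A" using insert.hyps(2) by blast
        ultimately have "partition_on (insert a A) (insert {a} P)"
          using pP by (simp add: partition_on_insert[OF d])
        then show "insert {a} P \<in> T1"
          using cP fin[OF pP] \<open>{a} \<notin> P\<close> by (simp add: T1_def T_def)
      qed
      show "(\<lambda>Q. Q - {{a}}) ` T1 \<subseteq> S l"
      proof (rule image_subsetI)
        fix Q assume Q: "Q \<in> T1"
        then have pQ: "partition_on (insert a A) Q" and "{a} \<in> Q" "card Q = Suc l"
          by (auto simp: T1_def T_def)
        moreover have "disjnt {a} (\<Union>(Q - {{a}}))"
          using disjnt_partition_remainder[OF pQ \<open>{a} \<in> Q\<close>] .
        moreover have "insert {a} (Q - {{a}}) = Q" using \<open>{a} \<in> Q\<close> by blast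
        moreover have "insert a A - {a} = A" using insert.hyps(2) by blast
        ultimately have "partition_on A (Q - {{a}})"
          using partition_on_insert[of "{a}" "Q - {{a}}" "insert a A"] by simp
        then show "Q - {{a}} \<in> S l"
          using \<open>{a} \<in> Q\<close> \<open>card Q = Suc l\<close> by (simp add: S_def)
      qed
    qed
    then have c1: "card T1 = card (S l)" by (simp add: bij_betw_same_card)
    \<comment> \<open>Puts \<open>a\<close> into the chosen block \<open>X\<close> of
      \<open>P\<close>. The choice of \<open>X\<close> contributes the factor
      \<open>Suc l\<close>.\<close>
    define g where "g = (\<lambda>(P, X). insert (insert a X) (P - {X}))"
    have "bij_betw g (SIGMA P:S (Suc l). P) T2"
      unfolding bij_betw_def
    proof
      \<comment> \<open>The pair can be read off its image: deleting \<open>a\<close> from every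
        block gives back \<open>P\<close>, and the only block containing \<open>a\<close> is
        \<open>insert a X\<close>.\<close>
      have rec: "(\<lambda>Y. Y - {a}) ` g (P, X) = P \<and> (\<forall>Y\<in>g (P, X). a \<in> Y \<longrightarrow> Y = insert a X)
          \<and> a \<notin> X \<and> insert a X \<in> g (P, X)"
        if "P \<in> S (Suc l)" "X \<in> P" for P X
      proof -
        have n: "a \<notin> Z" if "Z \<in> P" for Z using notin \<open>P \<in> S (Suc l)\<close> that by (auto simp: S_def)
        then have "(\<lambda>Y. Y - {a}) ` (P - {X}) = P - {X}" by (auto simp: image_iff)
        moreover have "insert a X - {a} = X" using n[OF \<open>X \<in> P\<close>] by auto
        ultimately show ?thesis using n \<open>X \<in> P\<close> by (auto simp: g_def)
      qed
      show "inj_on g (SIGMA P:S (Suc l). P)"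
      proof (rule inj_onI, clarify)
        fix P X P' X' assume *: "P \<in> S (Suc l)" "X \<in> P" "P' \<in> S (Suc l)" "X' \<in> P'"
          and eq: "g (P, X) = g (P', X')"
        note r = rec[OF *(1,2)] rec[OF *(3,4)]
        have "P = P'" using r eq by metis
        moreover have "insert a X = insert a X'" using r eq by (metis insertI1)
        then have "X = X'" using r by (metis insert_ident)
        ultimately show "P = P' \<and> X = X'" by simp
      qed
      show "g ` (SIGMA P:S (Suc l). P) = T2"
      proof (intro equalityI subsetI)
        fix Q assume "Q \<in> g ` (SIGMA P:S (Suc l). P)"
        then obtain P X where PX: "P \<in> S (Suc l)" "X \<in> P" and Q: "Q = g (P, X)" by auto
        then have pP: "partition_on A P" and cP: "card P = Suc l" by (auto simp: S_def)
        have d: "disjnt X (\<Union>(P - {X}))"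
          using disjnt_partition_remainder[OF pP PX(2)] .
        have p: "partition_on (A - X) (P - {X})" "X \<subseteq> A" "X \<noteq> {}"
          using partition_on_insert[OF d, of A] pP PX(2) by (simp_all add: insert_absorb)
        have d': "disjnt (insert a X) (\<Union>(P - {X}))"
          using d notin[OF pP] by (auto simp: disjnt_def)
        have "insert a A - insert a X = A - X" using insert.hyps(2) by auto
        then have "partition_on (insert a A) Q"
          using partition_on_insert[OF d', of "insert a A"] p by (auto simp: Q g_def)
        moreover have "insert a X \<notin> P - {X}" using notin[OF pP] by auto
        then have "card Q = Suc l"
          using cP PX(2) fin[OF pP] by (simp add: Q g_def card_insert_disjoint del: insert_Diff_single)
        moreover have "{a} \<notin> Q"
          using notin[OF pP] p(3) PX(2) by (auto simp: Q g_def)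
        ultimately show "Q \<in> T2" by (simp add: T2_def T_def)
      next
        fix Q assume "Q \<in> T2"
        then have pQ: "partition_on (insert a A) Q" and cQ: "card Q = Suc l" and na: "{a} \<notin> Q"
          by (auto simp: T2_def T_def)
        obtain Y where Y: "Y \<in> Q" "a \<in> Y" using partition_onD1[OF pQ] by auto
        define X where "X = Y - {a}"
        have YX: "Y = insert a X" using Y by (auto simp: X_def)
        \<comment> \<open>Since \<open>{a}\<close> is not a block of \<open>Q\<close>, the block of
          \<open>a\<close> has another element.\<close>
        have "X \<noteq> {}" using YX na Y by auto
        have d: "disjnt Y (\<Union>(Q - {Y}))"
          using disjnt_partition_remainder[OF pQ Y(1)] .
        then have d': "disjnt X (\<Union>(Q - {Y}))" by (auto simp: X_def disjnt_def)
        have q: "partition_on (insert a A - Y) (Q - {Y})" "Y \<subseteq> insert a A"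
          using partition_on_insert[OF d, of "insert a A"] pQ Y(1) by (simp_all add: insert_absorb)
        have "insert a A - Y = A - X" using insert.hyps(2) Y(2) by (auto simp: X_def)
        then have pP: "partition_on A (insert X (Q - {Y}))"
          using partition_on_insert[OF d', of A] q \<open>X \<noteq> {}\<close> by (auto simp: X_def)
        \<comment> \<open>A nonempty set disjoint from the other blocks is not one of them, so
          exchanging \<open>Y\<close> for \<open>X\<close> keeps the number of blocks.\<close>
        have nX: "X \<notin> Q - {Y}" using d' \<open>X \<noteq> {}\<close> by (auto simp: disjnt_def)
        then have "card (insert X (Q - {Y})) = Suc l"
          using cQ Y(1) fin'[OF pQ] by (simp add: card_insert_disjoint del: insert_Diff_single)
        then have "(insert X (Q - {Y}), X) \<in> (SIGMA P:S (Suc l). P)"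
          using pP by (auto simp: S_def)
        moreover have "g (insert X (Q - {Y}), X) = Q"
          using nX Y(1) YX by (auto simp: g_def)
        ultimately show "Q \<in> g ` (SIGMA P:S (Suc l). P)" by (metis imageI)
      qed
    qed
    then have "card T2 = card (SIGMA P:S (Suc l). P)" by (simp add: bij_betw_same_card)
    also have "\<dots> = (\<Sum>P\<in>S (Suc l). card P)"
      using finS fin by (intro card_SigmaI) (auto simp: S_def)
    also have "\<dots> = Suc l * card (S (Suc l))"
      by (simp add: S_def)
    finally have c2: "card T2 = Suc l * card (S (Suc l))" .
    have "T = T1 \<union> T2" "T1 \<inter> T2 = {}" by (auto simp: T1_def T2_def)
    then have "card T = card T1 + card T2"
      using finT by (metis card_Un_disjoint finite_Un)
    then show ?thesis
      using insert.IH insert.hyps c1 c2 Suc by (simp add: T_def S_def)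
  qed
qed

section \<open>Permutations with a given number of fixed points\<close>

text \<open>Transport along a bijection to the interval on which \<open>derangements\<close>
  counts.\<close>

lemma card_derangements_on:
  assumes "finite A"
  shows "card {\<pi>. \<pi> permutes A \<and> (\<forall>x\<in>A. \<pi> x \<noteq> x)} = derangements (card A)"
proof -
  have "\<exists>f. bij_betw f A {1..card A}"
    using assms by (intro finite_same_card_bij) auto
  then obtain f where "bij_betw f A {1..card A}" by blast
  from bij_betw_same_card[OF bij_betw_derangements[OF this]]
  show ?thesis by (simp add: derangements_def)
qed

text \<open>Group the permutations by their exact set \<open>F\<close> of fixed points: those
  belonging to \<open>F\<close> are the derangements of \<open>A - F\<close>.\<close>

lemma card_permutations_fixed_points:
  assumes "finite A" 
  shows "card {\<pi>. \<pi> permutes A \<and> card {x \<in> A. \<pi> x = x} = r}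
    = (card A choose r) * derangements (card A - r)"
proof -
  define D where "D F = {\<pi>. \<pi> permutes A \<and> {x \<in> A. \<pi> x = x} = F}" for F
  have "{\<pi>. \<pi> permutes A \<and> card {x \<in> A. \<pi> x = x} = r} = (\<Union>F\<in>{F. F \<subseteq> A \<and> card F = r}. D F)"
    by (auto simp: D_def)
  also have "card \<dots> = (\<Sum>F\<in>{F. F \<subseteq> A \<and> card F = r}. card (D F))"
  proof (rule card_UN_disjoint)
    show "finite {F. F \<subseteq> A \<and> card F = r}" using assms by simp
    show "\<forall>F\<in>{F. F \<subseteq> A \<and> card F = r}. finite (D F)"
      using finite_permutations[OF assms] by (auto simp: D_def intro: rev_finite_subset)
  qed (auto simp: D_def)
  also have "\<dots> = (\<Sum>F\<in>{F. F \<subseteq> A \<and> card F = r}. derangements (card A - r))"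
  proof (rule sum.cong[OF refl])
    fix F assume F: "F \<in> {F. F \<subseteq> A \<and> card F = r}"
    have "D F = {\<pi>. \<pi> permutes (A - F) \<and> (\<forall>x\<in>A - F. \<pi> x \<noteq> x)}"
    proof (intro equalityI subsetI)
      fix \<pi> assume "\<pi> \<in> D F"
      then show "\<pi> \<in> {\<pi>. \<pi> permutes (A - F) \<and> (\<forall>x\<in>A - F. \<pi> x \<noteq> x)}"
        by (auto simp: D_def intro: permutes_superset)
    next
      fix \<pi> assume "\<pi> \<in> {\<pi>. \<pi> permutes (A - F) \<and> (\<forall>x\<in>A - F. \<pi> x \<noteq> x)}"
      then show "\<pi> \<in> D F" 
        using F permutes_not_in[of \<pi> "A - F"] by (auto simp: D_def intro: permutes_subset)
    qed
    then show "card (D F) = derangements (card A - r)"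
      using card_derangements_on[of "A - F"] assms F by (simp add: card_Diff_subset[OF finite_subset[of F A]])
  qed
  also have "\<dots> = (card A choose r) * derangements (card A - r)"
    using n_subsets[OF assms] by simp
  finally show ?thesis .
qed

text \<open>Every reordering is \<open>permute_list \<pi> B\<close> for a unique \<pi>, and as
  \<open>B\<close> is distinct, it agrees with \<open>B\<close> exactly at the fixed points of
  \<pi>.\<close>

lemma card_reorderings_agreeing:
  assumes "distinct B"
  shows "card {Cs. distinct Cs \<and> set Cs = set B \<and> card {i. i < length Cs \<and> Cs ! i = B ! i} = r}
    = (length B choose r) * derangements (length B - r)"
proof -
  have "bij_betw (\<lambda>\<pi>. permute_list \<pi> B)
     {\<pi>. \<pi> permutes {..<length B} \<and> card {x \<in> {..<length B}. \<pi> x = x} = r}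
     {Cs. distinct Cs \<and> set Cs = set B \<and> card {i. i < length Cs \<and> Cs ! i = B ! i} = r}"
    unfolding bij_betw_def
  proof
    have fixes_iff: "{i. i < length B \<and> permute_list \<pi> B ! i = B ! i} = {x \<in> {..<length B}. \<pi> x = x}"
      if "\<pi> permutes {..<length B}" for \<pi>
    proof -
      have "permute_list \<pi> B ! i = B ! i \<longleftrightarrow> \<pi> i = i" if "i < length B" for i
        using that assms permutes_in_image[OF \<open>\<pi> permutes {..<length B}\<close>, of i]
        by (simp add: permute_list_nth[OF \<open>\<pi> permutes {..<length B}\<close>] nth_eq_iff_index_eq)
      then show ?thesis by auto
    qed
    show "inj_on (\<lambda>\<pi>. permute_list \<pi> B)
      {\<pi>. \<pi> permutes {..<length B} \<and> card {x \<in> {..<length B}. \<pi> x = x} = r}"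
    proof (rule inj_onI, clarify)
      fix \<pi> \<rho> assume p: "\<pi> permutes {..<length B}" "\<rho> permutes {..<length B}"
        and eq: "permute_list \<pi> B = permute_list \<rho> B"
      show "\<pi> = \<rho>"
      proof
        fix x
        show "\<pi> x = \<rho> x"
        proof (cases "x < length B")
          case True
          then have "B ! \<pi> x = B ! \<rho> x" using eq p by (metis permute_list_nth)
          then show ?thesis
            using assms True p permutes_in_image[of _ "{..<length B}" x]
            by (simp add: nth_eq_iff_index_eq)
        next
          case False
          then show ?thesis using p by (simp add: permutes_def)
        qed
      qed
    qed
    show "(\<lambda>\<pi>. permute_list \<pi> B) ` {\<pi>. \<pi> permutes {..<length B} \<and> card {x \<in> {..<length B}. \<pi> x = x} = r}
      = {Cs. distinct Cs \<and> set Cs = set B \<and> card {i. i < length Cs \<and> Cs ! i = B ! i} = r}"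
    proof (intro equalityI subsetI)
      fix Cs assume "Cs \<in> {Cs. distinct Cs \<and> set Cs = set B \<and> card {i. i < length Cs \<and> Cs ! i = B ! i} = r}"
      then have Cs: "distinct Cs" "set Cs = set B" "card {i. i < length Cs \<and> Cs ! i = B ! i} = r" by auto
      then have "mset Cs = mset B" using assms set_eq_iff_mset_eq_distinct by blast
      then obtain p where p: "p permutes {..<length B}" "permute_list p B = Cs"
        by (rule mset_eq_permutation)
      then show "Cs \<in> (\<lambda>\<pi>. permute_list \<pi> B) ` {\<pi>. \<pi> permutes {..<length B} \<and> card {x \<in> {..<length B}. \<pi> x = x} = r}"
        using fixes_iff[OF p(1)] Cs(3) by (intro image_eqI[of _ _ p]) (simp_all flip: p(2))
    next
      fix Cs assume "Cs \<in> (\<lambda>\<pi>. permute_list \<pi> B) ` {\<pi>. \<pi> permutes {..<length B} \<and> card {x \<in> {..<length B}. \<pi> x = x} = r}"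
      then obtain p where p: "p permutes {..<length B}" "card {x \<in> {..<length B}. p x = x} = r"
        and Cs: "Cs = permute_list p B" by blast
      show "Cs \<in> {Cs. distinct Cs \<and> set Cs = set B \<and> card {i. i < length Cs \<and> Cs ! i = B ! i} = r}"
        unfolding Cs using fixes_iff[OF p(1)] p assms by simp
    qed
  qed
  from bij_betw_same_card[OF this] card_permutations_fixed_points[of "{..<length B}" r]
  show ?thesis by simp
qed

section \<open>Ordered set partitions by number of fixed blocks\<close>

definition ordered_partitions :: "'a set \<Rightarrow> 'a set list set" where
  "ordered_partitions A = {Cs. distinct Cs \<and> partition_on A (set Cs)}"

text \<open>Blocks with equal minima share that element, so disjointness makes them equal. Hence the
  listing by minima depends only on the set of blocks.\<close>

lemma Min_inj_on_partition:
  fixes A :: "'a :: linorder set"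
  assumes "finite A" "partition_on A P"
  shows "inj_on Min P"
proof (rule inj_onI)
  fix X Y assume XY: "X \<in> P" "Y \<in> P" "Min X = Min Y"
  have "finite Z \<and> Z \<noteq> {}" if "Z \<in> P" for Z
    using that assms partition_onD1[OF assms(2)] partition_onD3[OF assms(2)]
    by (metis Union_upper finite_subset)
  then have "Min X \<in> X" "Min Y \<in> Y" using XY(1,2) Min_in by blast+
  then show "X = Y" using XY partition_onD2[OF assms(2)] unfolding disjoint_def by (metis IntI emptyE)
qed

text \<open>Group the lists by their underlying partition \<open>P\<close>. All orderings of
  \<open>P\<close> are compared with one standard listing \<open>B\<close>, so each group has the
  size given by \<open>card_reorderings_agreeing\<close>.\<close>

lemma card_ordered_partitions_fixed:
  fixes A :: "nat set"
  assumes "finite A"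
  shows "card {Cs \<in> ordered_partitions A. length Cs = m \<and> num_fixed_blocks Cs = r}
    = Stirling (card A) m * (m choose r) * derangements (m - r)"
proof -
  define Ps where "Ps = {P. partition_on A P \<and> card P = m}"
  define E where "E P = {Cs. distinct Cs \<and> set Cs = P \<and> num_fixed_blocks Cs = r}" for P :: "nat set set"
  have finP: "finite P" if "P \<in> Ps" for P
    using that finite_elements[OF assms] by (auto simp: Ps_def)
  have "{Cs \<in> ordered_partitions A. length Cs = m \<and> num_fixed_blocks Cs = r} = (\<Union>P\<in>Ps. E P)"
    by (auto simp: ordered_partitions_def Ps_def E_def distinct_card)
  also have "card \<dots> = (\<Sum>P\<in>Ps. card (E P))"
  proof (rule card_UN_disjoint)
    show "finite Ps" unfolding Ps_def
      by (rule finite_subset[OF _ finitely_many_partition_on[OF assms]]) auto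
    show "\<forall>P\<in>Ps. finite (E P)"
    proof
      fix P assume "P \<in> Ps"
      have "E P \<subseteq> {Cs. set Cs \<subseteq> P \<and> distinct Cs}"
        by (auto simp: E_def)
      moreover have "finite {Cs. set Cs \<subseteq> P \<and> distinct Cs}"
        by (rule finite_subset_distinct[OF finP[OF \<open>P \<in> Ps\<close>]])
      ultimately show "finite (E P)" by (rule finite_subset)
    qed
  qed (auto simp: E_def)
  also have "\<dots> = (\<Sum>P\<in>Ps. (m choose r) * derangements (m - r))"
  proof (rule sum.cong[OF refl])
    fix P assume P: "P \<in> Ps"
    obtain xs where xs: "set xs = P" "distinct xs"
      using finite_distinct_list[OF finP[OF P]] by blast
    define B where "B = sort_key Min xs"
    have B: "distinct B" "set B = P" "length B = m"
      using xs P distinct_card[OF xs(2)] by (auto simp: B_def Ps_def)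
    have inj: "inj_on Min P" using Min_inj_on_partition[OF assms] P by (auto simp: Ps_def)
    \<comment> \<open>\<open>Min\<close> is injective on \<open>P\<close>, so the sorted list
      depends only on the multiset of blocks.\<close>
    have sB: "sort_key Min Cs = B" if "distinct Cs" "set Cs = P" for Cs
      unfolding B_def
    proof (rule sort_key_inj_key_eq)
      show "mset Cs = mset (sort_key Min xs)"
        using that xs set_eq_iff_mset_eq_distinct[of Cs xs] by simp
      show "inj_on Min (set Cs)" using that inj by simp
      show "sorted (map Min (sort_key Min xs))" by simp
    qed
    have "E P = {Cs. distinct Cs \<and> set Cs = set B \<and> card {i. i < length Cs \<and> Cs ! i = B ! i} = r}"
      unfolding E_def B(2) num_fixed_blocks_def using sB by (intro Collect_cong) auto
    then show "card (E P) = (m choose r) * derangements (m - r)"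
      using card_reorderings_agreeing[OF B(1), of r] B(3) by simp
  qed
  finally show ?thesis using card_partition_on[OF assms, of m] by (simp add: Ps_def)
qed

section \<open>The outcome of the parking process, without recursion\<close>

lemma park_Cons_eq_Some_iff:
  assumes "finite F"
  shows "park F (a # as) = Some (t # ts) \<longleftrightarrow>
    t \<in> F \<and> a \<le> t \<and> (\<forall>u\<in>F. a \<le> u \<longrightarrow> t \<le> u) \<and> park (F - {t}) as = Some ts"
proof (cases "{s \<in> F. a \<le> s} = {}")
  case False
  have "Min {s \<in> F. a \<le> s} = t \<longleftrightarrow> t \<in> F \<and> a \<le> t \<and> (\<forall>u\<in>F. a \<le> u \<longrightarrow> t \<le> u)"
    using assms False by (subst Min_eq_iff) auto
  then show ?thesis using False by (auto simp: Let_def simp del: Collect_empty_eq)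
qed auto

text \<open>A car takes the first free spot exactly if each spot of \<open>F\<close> that it passes,
  starting with its preference, already holds an earlier car.\<close>

lemma park_eq_Some_iff:
  assumes "finite F"
  shows "park F \<alpha> = Some s \<longleftrightarrow> length s = length \<alpha> \<and> distinct s \<and> set s \<subseteq> F \<and>
    (\<forall>i<length \<alpha>. \<alpha> ! i \<le> s ! i \<and> (\<forall>t\<in>F. \<alpha> ! i \<le> t \<and> t < s ! i \<longrightarrow> (\<exists>j<i. s ! j = t)))"
  using assms
proof (induction \<alpha> arbitrary: F s)
  case Nil
  then show ?case by auto
next
  case (Cons a as)
  show ?case
  proof (cases s)
    case Nil
    then show ?thesis by (auto simp: Let_def)
  next
    case (Cons t ts)
    \<comment> \<open>The spot \<open>t\<close> of the first car is missing from the smaller set; on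
      the right it is witnessed by \<open>j = 0\<close>.\<close>
    have "(\<forall>u\<in>F - {t}. as ! i \<le> u \<and> u < ts ! i \<longrightarrow> (\<exists>j<i. ts ! j = u)) \<longleftrightarrow>
        (\<forall>u\<in>F. as ! i \<le> u \<and> u < ts ! i \<longrightarrow> (\<exists>j<Suc i. (t # ts) ! j = u))" for i
      by (auto simp: Ex_less_Suc2)
    moreover have "(\<forall>u\<in>F. a \<le> u \<longrightarrow> t \<le> u) \<longleftrightarrow> (\<forall>u\<in>F. \<not> (a \<le> u \<and> u < t))"
      by (meson not_le)
    ultimately show ?thesis
      unfolding Cons using Cons.prems
      by (subst park_Cons_eq_Some_iff) (auto simp: Cons.IH All_less_Suc2 simp del: park.simps)
  qed
qed

section \<open>Unit interval parking functions\<close>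

text \<open>Car \<open>i\<close> has preference \<open>a i\<close> and parks in spot \<open>s i\<close>.\<close>

locale unit_parking =
  fixes n :: nat and a s :: "nat \<Rightarrow> nat"
  assumes bij: "bij_betw s {1..n} {1..n}"
    and pos: "i \<in> {1..n} \<Longrightarrow> 1 \<le> a i"
    and step: "i \<in> {1..n} \<Longrightarrow> s i = a i \<or> s i = Suc (a i) \<and> (\<exists>j\<in>{1..<i}. s j = a i)"

text \<open>A car displaced by 1 passes only its preferred spot, which must then hold an earlier
  car; this is the second case of \<open>step\<close>. Conversely, \<open>step\<close> leaves no
  other spot to be checked in \<open>park_eq_Some_iff\<close>.\<close>

lemma UPF_iff: "\<alpha> \<in> UPF n \<longleftrightarrow> length \<alpha> = n \<and> (\<exists>s. unit_parking n (\<lambda>i. \<alpha> ! (i - 1)) s)"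
proof
  assume "\<alpha> \<in> UPF n"
  then have len: "length \<alpha> = n" and set: "set \<alpha> \<subseteq> {1..n}"
    and unit: "\<And>i. i \<in> {1..n} \<Longrightarrow> int (the (park {1..n} \<alpha>) ! (i - 1)) - int (\<alpha> ! (i - 1)) \<in> {0, 1}"
    and "park {1..n} \<alpha> \<noteq> None"
    by (auto simp: UPF_def parking_functions_def)
  then obtain ss where park: "park {1..n} \<alpha> = Some ss" by auto
  then have ss: "length ss = n" "distinct ss" "set ss \<subseteq> {1..n}"
    and free: "\<And>i t. i < n \<Longrightarrow> t \<in> {1..n} \<Longrightarrow> \<alpha> ! i \<le> t \<Longrightarrow> t < ss ! i \<Longrightarrow> \<exists>j<i. ss ! j = t"
    using len by (simp_all add: park_eq_Some_iff)
  have "unit_parking n (\<lambda>i. \<alpha> ! (i - 1)) (\<lambda>i. ss ! (i - 1))"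
  proof
    have "inj_on (\<lambda>i. ss ! (i - 1)) {1..n}"
      using ss by (auto simp: inj_on_def nth_eq_iff_index_eq)
    moreover have "(\<lambda>i. ss ! (i - 1)) ` {1..n} \<subseteq> {1..n}"
    proof (rule image_subsetI)
      fix i assume "i \<in> {1..n}"
      then show "ss ! (i - 1) \<in> {1..n}" using ss by (intro subsetD[OF ss(3)] nth_mem) auto
    qed
    ultimately show "bij_betw (\<lambda>i. ss ! (i - 1)) {1..n} {1..n}"
      by (simp add: bij_betw_def endo_inj_surj)
  next
    fix i assume i: "i \<in> {1..n}"
    then have "i - 1 < n" by auto
    then have a: "\<alpha> ! (i - 1) \<in> {1..n}" using set len nth_mem by blast
    then show "1 \<le> \<alpha> ! (i - 1)" by simp
    show "ss ! (i - 1) = \<alpha> ! (i - 1) \<or>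
      ss ! (i - 1) = Suc (\<alpha> ! (i - 1)) \<and> (\<exists>j\<in>{1..<i}. ss ! (j - 1) = \<alpha> ! (i - 1))"
    proof (cases "ss ! (i - 1) = \<alpha> ! (i - 1)")
      case False
      then have s: "ss ! (i - 1) = Suc (\<alpha> ! (i - 1))" using unit[OF i] park by auto
      then obtain j where "j < i - 1" "ss ! j = \<alpha> ! (i - 1)"
        using free[OF \<open>i - 1 < n\<close> a] by auto
      then show ?thesis using s by (auto intro!: bexI[of _ "Suc j"])
    qed simp
  qed
  then show "length \<alpha> = n \<and> (\<exists>s. unit_parking n (\<lambda>i. \<alpha> ! (i - 1)) s)" using len by blast
next
  assume "length \<alpha> = n \<and> (\<exists>s. unit_parking n (\<lambda>i. \<alpha> ! (i - 1)) s)"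
  then obtain s where len: "length \<alpha> = n" and "unit_parking n (\<lambda>i. \<alpha> ! (i - 1)) s" by blast
  then interpret unit_parking n "\<lambda>i. \<alpha> ! (i - 1)" s by simp
  define ss where "ss = map s [1..<Suc n]"
  have nth: "ss ! i = s (Suc i)" if "i < n" for i using that by (simp add: ss_def del: upt_Suc)
  have st: "ss ! i = \<alpha> ! i \<or> ss ! i = Suc (\<alpha> ! i) \<and> (\<exists>j<i. ss ! j = \<alpha> ! i)" if "i < n" for i
  proof -
    have "(\<exists>j<i. ss ! j = \<alpha> ! i)" if "j \<in> {1..<Suc i}" "s j = \<alpha> ! i" for j
      using that nth[of "j - 1"] \<open>i < n\<close> by (intro exI[of _ "j - 1"]) auto
    then show ?thesis using step[of "Suc i"] nth[OF that] that by auto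
  qed
  have range: "s i \<in> {1..n}" if "i \<in> {1..n}" for i using that bij bij_betwE by blast
  \<comment> \<open>The upper bound comes from the spots, as a preference is at most the spot taken;
    the lower bound is \<open>pos\<close>.\<close>
  have "set \<alpha> \<subseteq> {1..n}"
  proof
    fix x assume "x \<in> set \<alpha>"
    then obtain i where "i < n" "x = \<alpha> ! i" using len by (auto simp: in_set_conv_nth)
    then show "x \<in> {1..n}" using st[of i] nth[of i] pos[of "Suc i"] range[of "Suc i"] by auto
  qed
  moreover have park: "park {1..n} \<alpha> = Some ss"
  proof -
    have "length ss = n" by (simp add: ss_def)
    moreover have "distinct ss"
      using bij by (auto simp: ss_def distinct_map bij_betw_def atLeastLessThanSuc_atLeastAtMost simp del: upt_Suc)
    moreover have "set ss \<subseteq> {1..n}" using range by (auto simp: ss_def simp del: upt_Suc)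
    moreover have "\<alpha> ! i \<le> ss ! i \<and> (\<forall>t\<in>{1..n}. \<alpha> ! i \<le> t \<and> t < ss ! i \<longrightarrow> (\<exists>j<i. ss ! j = t))"
      if "i < n" for i
      using st[OF that] by (auto simp: less_Suc_eq_le dest: le_antisym)
    ultimately show ?thesis using len by (simp add: park_eq_Some_iff)
  qed
  moreover have "int (ss ! (i - 1)) - int (\<alpha> ! (i - 1)) \<in> {0, 1}" if "i \<in> {1..n}" for i
    using st[of "i - 1"] that by auto
  ultimately show "\<alpha> \<in> UPF n" using len by (simp add: UPF_def parking_functions_def)
qed

section \<open>Block starts and block indices\<close>

definition start_set :: "nat list \<Rightarrow> nat set" where
  "start_set \<alpha> = {i \<in> {1..length \<alpha>}. sort \<alpha> ! (i - 1) = i}"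

text \<open>Counting the block starts up to the preference gives the index of the block, numbered
  from 1, without reference to the sorted list or its sentinel.\<close>

definition block_index :: "nat list \<Rightarrow> nat \<Rightarrow> nat" where
  "block_index \<alpha> i = card {l \<in> start_set \<alpha>. l \<le> \<alpha> ! (i - 1)}"

lemma num_blocks_eq: "num_blocks \<alpha> = card (start_set \<alpha>)"
  by (simp add: num_blocks_def block_starts_def start_set_def)

text \<open>The entries up to \<open>x\<close> form an initial segment of the list, so entry
  \<open>k\<close> is among them iff there are more than \<open>k\<close> of them.\<close>

lemma nth_le_iff_less_card:
  fixes xs :: "'a :: linorder list"
  assumes "sorted_wrt (<) xs" "k < length xs"
  shows "xs ! k \<le> x \<longleftrightarrow> k < card {l \<in> set xs. l \<le> x}"
proof -
  have "{l \<in> set xs. l \<le> x} = (!) xs ` {i. i < length xs \<and> xs ! i \<le> x}"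
    by (auto simp: in_set_conv_nth)
  moreover have "inj_on ((!) xs) {i. i < length xs \<and> xs ! i \<le> x}"
    using assms(1) by (auto simp: inj_on_def strict_sorted_iff nth_eq_iff_index_eq)
  ultimately have c: "card {l \<in> set xs. l \<le> x} = card {i. i < length xs \<and> xs ! i \<le> x}"
    by (simp add: card_image)
  have mono: "xs ! i \<le> xs ! j" if "i \<le> j" "j < length xs" for i j
    using that assms(1) by (simp add: strict_sorted_iff sorted_nth_mono)
  show ?thesis
  proof (cases "xs ! k \<le> x")
    case True
    then have "{..k} \<subseteq> {i. i < length xs \<and> xs ! i \<le> x}"
      using mono[of _ k] assms(2) by force
    from card_mono[OF _ this] show ?thesis using True c by simp
  next
    case False
    then have "{i. i < length xs \<and> xs ! i \<le> x} \<subseteq> {..<k}"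
      using mono[of k] assms(2) by (force simp: not_le[symmetric])
    from card_mono[OF _ this] show ?thesis using False c by simp
  qed
qed

text \<open>Each of the two bounds defining the car set is a comparison of the block index with
  \<open>j\<close>.\<close>

lemma car_set_eq:
  assumes "\<forall>x\<in>set \<alpha>. x \<le> length \<alpha>" "j \<in> {1..num_blocks \<alpha>}"
  shows "car_set \<alpha> j = {i \<in> {1..length \<alpha>}. block_index \<alpha> i = j}"
proof -
  define xs where "xs = block_starts \<alpha>"
  have xs: "sorted_wrt (<) xs" "set xs = start_set \<alpha>" "length xs = num_blocks \<alpha>"
    by (simp_all add: xs_def block_starts_def start_set_def num_blocks_def)
  have "(xs @ [length \<alpha> + 1]) ! (j - 1) \<le> \<alpha> ! (i - 1) \<and> \<alpha> ! (i - 1) < (xs @ [length \<alpha> + 1]) ! j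
      \<longleftrightarrow> block_index \<alpha> i = j" if "i \<in> {1..length \<alpha>}" for i
  proof -
    have le: "block_index \<alpha> i \<le> num_blocks \<alpha>"
      unfolding block_index_def num_blocks_eq by (rule card_mono) (auto simp: start_set_def)
    have "\<alpha> ! (i - 1) \<in> set \<alpha>" using that by (intro nth_mem) auto
    then have "\<alpha> ! (i - 1) < length \<alpha> + 1" using assms(1) by (auto simp: less_Suc_eq_le)
    \<comment> \<open>For the last block the entry is the sentinel, and both sides hold: the left
      one by the bound on preferences, the right one by \<open>le\<close>.\<close>
    then have "\<alpha> ! (i - 1) < (xs @ [length \<alpha> + 1]) ! j \<longleftrightarrow> block_index \<alpha> i \<le> j"
      using nth_le_iff_less_card[OF xs(1), of j "\<alpha> ! (i - 1)"] xs(2,3) assms(2) le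
      by (auto simp: nth_append block_index_def)
    moreover have "(xs @ [length \<alpha> + 1]) ! (j - 1) \<le> \<alpha> ! (i - 1) \<longleftrightarrow> j \<le> block_index \<alpha> i"
      using nth_le_iff_less_card[OF xs(1), of "j - 1" "\<alpha> ! (i - 1)"] xs(2,3) assms(2)
      by (auto simp: nth_append block_index_def)
    ultimately show ?thesis by auto
  qed
  then show ?thesis unfolding car_set_def Let_def xs_def by blast
qed

section \<open>Spots and preferences as functions of the block index\<close>

definition block_rank :: "nat \<Rightarrow> (nat \<Rightarrow> nat) \<Rightarrow> nat \<Rightarrow> nat" where
  "block_rank n \<beta> i = card {k \<in> {1..n}. \<beta> k < \<beta> i \<or> \<beta> k = \<beta> i \<and> k \<le> i}"

text \<open>The subtraction is not truncated for \<open>i \<in> {1..n}\<close>, since the rank counts \<open>i\<close> itself.\<close>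

definition preference :: "nat \<Rightarrow> (nat \<Rightarrow> nat) \<Rightarrow> nat \<Rightarrow> nat" where
  "preference n \<beta> i =
    (if \<exists>k\<in>{1..<i}. \<beta> k = \<beta> i then block_rank n \<beta> i - 1 else block_rank n \<beta> i)"

context unit_parking
begin

definition lucky :: "nat set" where
  "lucky = {i \<in> {1..n}. s i = a i}"

text \<open>The block index computed from the spots of lucky cars instead of the sorted tuple;
  \<open>block_index_eq\<close> shows that both agree.\<close>

definition block :: "nat \<Rightarrow> nat" where
  "block i = card {k \<in> lucky. s k \<le> s i}"

lemma finite_lucky: "finite lucky"
  by (simp add: lucky_def)

lemma s_eq_iff: "i \<in> {1..n} \<Longrightarrow> k \<in> {1..n} \<Longrightarrow> s i = s k \<longleftrightarrow> i = k"
  using bij by (auto simp: bij_betw_def inj_on_eq_iff)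

lemma inj_on_lucky: "inj_on s lucky"
  using bij by (rule inj_on_subset[OF bij_betw_imp_inj_on]) (auto simp: lucky_def)

lemma s_in: "i \<in> {1..n} \<Longrightarrow> s i \<in> {1..n}"
  using bij bij_betwE by blast

text \<open>The two conditions could differ only if \<open>s k = s i = Suc (a i)\<close>, which
  would make the lucky car \<open>k\<close> equal to the unlucky car \<open>i\<close>.\<close>

lemma lucky_le_iff:
  assumes "k \<in> lucky" "i \<in> {1..n}"
  shows "s k \<le> a i \<longleftrightarrow> s k \<le> s i"
proof -
  have "s k \<noteq> s i" if "s i \<noteq> a i" using assms that s_eq_iff by (auto simp: lucky_def)
  then show ?thesis using step[OF assms(2)] by auto
qed

lemma block_mono: "s i \<le> s k \<Longrightarrow> block i \<le> block k"
  unfolding block_def by (rule card_mono) (auto simp: finite_lucky)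

lemma block_less_lucky:
  assumes "k \<in> lucky" "s i < s k"
  shows "block i < block k"
proof -
  have "k \<in> {k' \<in> lucky. s k' \<le> s k} - {k \<in> lucky. s k \<le> s i}" using assms by auto
  moreover have "{k \<in> lucky. s k \<le> s i} \<subseteq> {k' \<in> lucky. s k' \<le> s k}" using assms by auto
  ultimately show ?thesis
    unfolding block_def using finite_lucky by (intro psubset_card_mono) auto
qed

text \<open>Car \<open>k\<close> is not lucky, for it would open a new block after \<open>i\<close>.
  So the spot before it holds an earlier car, and descending spot by spot leads to
  \<open>i\<close>.\<close>

lemma spot_less_imp_less:
  assumes "i \<in> {1..n}" "k \<in> {1..n}" "block i = block k" "s i < s k"
  shows "i < k"
  using assms
proof (induction "s k" arbitrary: k rule: less_induct)
  case less
  have "k \<notin> lucky" using block_less_lucky[of k i] less.prems by auto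
  then obtain j where j: "j \<in> {1..<k}" "s j = a k" "s k = Suc (a k)"
    using step[of k] less.prems by (auto simp: lucky_def)
  have jn: "j \<in> {1..n}" using j less.prems by auto
  show ?case
  proof (cases "s i = s j")
    case True
    then show ?thesis using j jn less.prems s_eq_iff[of i j] by auto
  next
    case False
    then have "s i < s j" "s j < s k" using j less.prems by auto
    \<comment> \<open>\<open>block\<close> is monotone in the spots and takes equal values at both
      ends.\<close>
    moreover then have "block i = block j"
      using block_mono[of i j] block_mono[of j k] less.prems by auto
    ultimately show ?thesis using less.hyps[of j] jn less.prems j(1) by auto
  qed
qed

lemma spot_le_iff:
  assumes "i \<in> {1..n}" "k \<in> {1..n}"
  shows "s i \<le> s k \<longleftrightarrow> block i < block k \<or> block i = block k \<and> i \<le> k"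
proof (cases "s i" "s k" rule: linorder_cases)
  case less
  then show ?thesis using block_mono[of i k] spot_less_imp_less[OF assms] by auto
next
  case equal
  then show ?thesis using s_eq_iff[OF assms] by auto
next
  case greater
  then show ?thesis using block_mono[of k i] spot_less_imp_less[OF assms(2,1)] by auto
qed

text \<open>As the cars fill all spots, \<open>s i\<close> is the number of cars in spots up to
  \<open>s i\<close>; \<open>spot_le_iff\<close> describes these cars by \<open>block\<close>
  alone.\<close>

lemma spot_eq_block_rank:
  assumes "i \<in> {1..n}"
  shows "s i = block_rank n block i"
proof -
  have "block_rank n block i = card {k \<in> {1..n}. s k \<le> s i}"
    unfolding block_rank_def using spot_le_iff[OF _ assms] by (intro arg_cong[where f = card]) auto
  also have "\<dots> = card (s ` {k \<in> {1..n}. s k \<le> s i})"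
    by (rule card_image[symmetric], rule inj_on_subset[OF bij_betw_imp_inj_on[OF bij]]) auto
  also have "s ` {k \<in> {1..n}. s k \<le> s i} = {l \<in> s ` {1..n}. l \<le> s i}" by auto
  also have "\<dots> = {1..s i}" using s_in[OF assms] bij by (auto simp: bij_betw_def)
  finally show ?thesis by simp
qed

text \<open>A smaller car of the same block would stand before \<open>i\<close>, but a lucky car
  opens its block. An unlucky car shares its block with the earlier car that took its preferred
  spot.\<close>

lemma lucky_iff:
  assumes "i \<in> {1..n}"
  shows "i \<in> lucky \<longleftrightarrow> \<not> (\<exists>k\<in>{1..<i}. block k = block i)"
proof
  assume "i \<in> lucky"
  show "\<not> (\<exists>k\<in>{1..<i}. block k = block i)"
  proof
    assume "\<exists>k\<in>{1..<i}. block k = block i"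
    then obtain k where k: "k \<in> {1..<i}" "block k = block i" by blast
    then have "k \<in> {1..n}" using assms by auto
    then have "s k < s i" using spot_le_iff[OF assms, of k] k by (auto simp: not_le[symmetric])
    then show False using block_less_lucky[OF \<open>i \<in> lucky\<close> \<open>s k < s i\<close>] k by auto
  qed
next
  assume none: "\<not> (\<exists>k\<in>{1..<i}. block k = block i)"
  show "i \<in> lucky"
  proof (rule ccontr)
    assume "i \<notin> lucky"
    then obtain j where j: "j \<in> {1..<i}" "s j = a i"
      using step[OF assms] assms by (auto simp: lucky_def)
    \<comment> \<open>The counts up to \<open>s j = a i\<close> and up to \<open>s i\<close>
      coincide by \<open>lucky_le_iff\<close>.\<close>
    then have "block j = block i"
      using lucky_le_iff[OF _ assms] unfolding block_def by (intro arg_cong[where f = card]) auto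
    then show False using none j by blast
  qed
qed

text \<open>Thus \<open>block\<close> determines the tuple, which yields injectivity of the block
  partition.\<close>

lemma preference_eq:
  assumes "i \<in> {1..n}"
  shows "a i = preference n block i"
proof (cases "i \<in> lucky")
  case True
  then show ?thesis using lucky_iff[OF assms] spot_eq_block_rank[OF assms]
    by (auto simp: preference_def lucky_def)
next
  case False
  then have "s i = Suc (a i)" using step[OF assms] assms by (auto simp: lucky_def)
  then show ?thesis using lucky_iff[OF assms] spot_eq_block_rank[OF assms] False
    by (auto simp: preference_def)
qed

lemma block_in:
  assumes "i \<in> {1..n}"
  shows "block i \<in> {1..card lucky}"
proof -
  have "1 \<in> s ` {1..n}" using assms bij by (auto simp: bij_betw_def)
  then obtain k where k: "k \<in> {1..n}" "s k = 1" by force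
  \<comment> \<open>An unlucky car in spot 1 would have preference 0.\<close>
  then have "k \<in> lucky" using step[OF k(1)] pos[OF k(1)] by (auto simp: lucky_def)
  then have "{k \<in> lucky. s k \<le> s i} \<noteq> {}" using s_in[OF assms] k by auto
  then have "block i > 0" unfolding block_def by (simp add: card_gt_0_iff finite_lucky del: Collect_empty_eq)
  moreover have "block i \<le> card lucky"
    unfolding block_def by (rule card_mono) (auto simp: finite_lucky)
  ultimately show ?thesis by simp
qed

text \<open>Each lucky car is the smallest of its block, so \<open>block\<close> is injective on the
  lucky cars, and their values already exhaust the range.\<close>

lemma image_block: "block ` {1..n} = {1..card lucky}"
proof
  show "block ` {1..n} \<subseteq> {1..card lucky}" using block_in by blast
  have "inj_on block lucky"
  proof (rule inj_onI)
    fix i k assume ik: "i \<in> lucky" "k \<in> lucky" and eq: "block i = block k"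
    then have "i \<in> {1..n}" "k \<in> {1..n}" by (auto simp: lucky_def)
    then show "i = k" using lucky_iff[of i] lucky_iff[of k] ik eq
      by (cases i k rule: linorder_cases) force+
  qed
  then have "card (block ` lucky) = card {1..card lucky}" by (simp add: card_image)
  moreover have "block ` lucky \<subseteq> {1..card lucky}" using block_in by (auto simp: lucky_def)
  ultimately have "block ` lucky = {1..card lucky}" by (intro card_subset_eq) auto
  moreover have "lucky \<subseteq> {1..n}" by (auto simp: lucky_def)
  ultimately show "{1..card lucky} \<subseteq> block ` {1..n}" by blast
qed

end

text \<open>Let \<open>b p\<close> be the preference of the car in spot \<open>p\<close>. It is
  \<open>p\<close> or \<open>p - 1\<close>, so \<open>b\<close> is weakly increasing and lists the
  sorted tuple; \<open>b p = p\<close> says that this car is lucky.\<close>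

lemma start_set_eq:
  assumes "length \<alpha> = n" "unit_parking n (\<lambda>i. \<alpha> ! (i - 1)) s"
  shows "start_set \<alpha> = s ` unit_parking.lucky n (\<lambda>i. \<alpha> ! (i - 1)) s"
proof -
  note One_nat_def [simp del]
  interpret unit_parking n "\<lambda>i. \<alpha> ! (i - 1)" s by fact
  define \<sigma> where "\<sigma> = inv_into {1..n} s"
  define b where "b p = \<alpha> ! (\<sigma> p - 1)" for p
  have \<sigma>: "bij_betw \<sigma> {1..n} {1..n}" unfolding \<sigma>_def by (rule bij_betw_inv_into[OF bij])
  have s\<sigma>: "s (\<sigma> p) = p" if "p \<in> {1..n}" for p
    unfolding \<sigma>_def using bij that by (rule bij_betw_inv_into_right)
  have \<sigma>_in: "\<sigma> p \<in> {1..n}" if "p \<in> {1..n}" for p using \<sigma> that bij_betwE by blast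
  have b: "b p = p \<or> Suc (b p) = p" if "p \<in> {1..n}" for p
    using step[OF \<sigma>_in[OF that]] s\<sigma>[OF that] by (auto simp: b_def)
  have "sort \<alpha> = map b [1..<Suc n]"
  proof (rule properties_for_sort)
    have "mset (map b [1..<Suc n]) = image_mset b (mset_set {1..n})"
      by (simp add: atLeastLessThanSuc_atLeastAtMost del: upt_Suc flip: mset_set_upto_eq_mset_upto)
    also have "\<dots> = image_mset (\<lambda>i. \<alpha> ! (i - 1)) (image_mset \<sigma> (mset_set {1..n}))"
      unfolding b_def multiset.map_comp comp_def ..
    also have "image_mset \<sigma> (mset_set {1..n}) = mset_set {1..n}"
      using \<sigma> by (simp add: image_mset_mset_set bij_betw_def)
    also have "image_mset (\<lambda>i. \<alpha> ! (i - 1)) (mset_set {1..n}) = mset (map (\<lambda>i. \<alpha> ! (i - 1)) [1..<Suc n])"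
      by (simp add: atLeastLessThanSuc_atLeastAtMost del: upt_Suc flip: mset_set_upto_eq_mset_upto)
    also have "map (\<lambda>i. \<alpha> ! (i - 1)) [1..<Suc n] = \<alpha>"
      using assms(1) by (intro nth_equalityI) (auto simp del: upt_Suc)
    finally show "mset (map b [1..<Suc n]) = mset \<alpha>" .
    \<comment> \<open>For \<open>p < q\<close>,
      \<open>b p \<le> p \<le> q - 1 \<le> b q\<close>.\<close>
    have "b p \<le> b q" if "p \<in> {1..n}" "q \<in> {1..n}" "p \<le> q" for p q
      using b[OF that(1)] b[OF that(2)] that(3) by (cases "p = q") auto
    then show "sorted (map b [1..<Suc n])"
      by (auto simp: sorted_iff_nth_mono simp del: upt_Suc)
  qed
  then have "sort \<alpha> ! (p - 1) = b p" if "p \<in> {1..n}" for p using that by (auto simp del: upt_Suc)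
  then have "start_set \<alpha> = {p \<in> {1..n}. b p = p}" using assms(1) by (auto simp: start_set_def)
  also have "\<dots> = s ` lucky"
  proof (intro equalityI subsetI)
    fix p assume "p \<in> {p \<in> {1..n}. b p = p}"
    then show "p \<in> s ` lucky"
      using s\<sigma>[of p] \<sigma>_in[of p] by (intro image_eqI[of _ _ "\<sigma> p"]) (auto simp: lucky_def b_def)
  next
    fix p assume "p \<in> s ` lucky"
    then obtain i where i: "i \<in> {1..n}" "s i = \<alpha> ! (i - 1)" "p = s i" by (auto simp: lucky_def)
    have "\<sigma> p = i" unfolding \<sigma>_def i(3) by (rule bij_betw_inv_into_left[OF bij i(1)])
    then show "p \<in> {p \<in> {1..n}. b p = p}" using i s_in[OF i(1)] by (auto simp: b_def)
  qed
  finally show ?thesis .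
qed

text \<open>By \<open>lucky_le_iff\<close>, the starts up to the preference are the spots, up to
  \<open>s i\<close>, of lucky cars.\<close>

lemma block_index_eq:
  assumes "length \<alpha> = n" "unit_parking n (\<lambda>i. \<alpha> ! (i - 1)) s" "i \<in> {1..n}"
  shows "block_index \<alpha> i = unit_parking.block n (\<lambda>i. \<alpha> ! (i - 1)) s i"
proof -
  note One_nat_def [simp del]
  interpret unit_parking n "\<lambda>i. \<alpha> ! (i - 1)" s by fact
  have "{l \<in> start_set \<alpha>. l \<le> \<alpha> ! (i - 1)} = s ` {k \<in> lucky. s k \<le> s i}"
    using lucky_le_iff[OF _ assms(3)] by (auto simp: start_set_eq[OF assms(1,2)])
  moreover have "inj_on s {k \<in> lucky. s k \<le> s i}"
    by (rule inj_on_subset[OF inj_on_lucky]) auto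
  ultimately show ?thesis by (simp add: block_index_def block_def card_image)
qed

lemma num_blocks_eq_card_lucky:
  assumes "length \<alpha> = n" "unit_parking n (\<lambda>i. \<alpha> ! (i - 1)) s"
  shows "num_blocks \<alpha> = card (unit_parking.lucky n (\<lambda>i. \<alpha> ! (i - 1)) s)"
proof -
  note One_nat_def [simp del]
  interpret unit_parking n "\<lambda>i. \<alpha> ! (i - 1)" s by fact
  show ?thesis by (simp add: num_blocks_eq start_set_eq[OF assms] card_image[OF inj_on_lucky])
qed

section \<open>The parking function with a given block index\<close>

text \<open>The ranks count initial segments of a linear order, which are nested.\<close>

lemma block_rank_le_iff:
  assumes "i \<in> {1..n}" "k \<in> {1..n}"
  shows "block_rank n \<beta> i \<le> block_rank n \<beta> k \<longleftrightarrow> \<beta> i < \<beta> k \<or> \<beta> i = \<beta> k \<and> i \<le> k"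
proof
  assume "\<beta> i < \<beta> k \<or> \<beta> i = \<beta> k \<and> i \<le> k"
  then show "block_rank n \<beta> i \<le> block_rank n \<beta> k"
    unfolding block_rank_def by (intro card_mono) auto
next
  assume le: "block_rank n \<beta> i \<le> block_rank n \<beta> k"
  show "\<beta> i < \<beta> k \<or> \<beta> i = \<beta> k \<and> i \<le> k"
  proof (rule ccontr)
    assume neg: "\<not> (\<beta> i < \<beta> k \<or> \<beta> i = \<beta> k \<and> i \<le> k)"
    let ?D = "\<lambda>i. {j \<in> {1..n}. \<beta> j < \<beta> i \<or> \<beta> j = \<beta> i \<and> j \<le> i}"
    have "?D k \<subseteq> ?D i" "i \<in> ?D i - ?D k" using neg assms by auto
    then have "card (?D k) < card (?D i)" by (intro psubset_card_mono) auto
    then show False using le by (simp add: block_rank_def)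
  qed
qed

lemma block_rank_in:
  assumes "i \<in> {1..n}"
  shows "block_rank n \<beta> i \<in> {1..n}"
proof -
  have "{k \<in> {1..n}. \<beta> k < \<beta> i \<or> \<beta> k = \<beta> i \<and> k \<le> i} \<noteq> {}" using assms by auto
  then have "block_rank n \<beta> i > 0"
    unfolding block_rank_def by (simp add: card_gt_0_iff del: Collect_empty_eq)
  moreover have "block_rank n \<beta> i \<le> card {1..n}"
    unfolding block_rank_def by (intro card_mono) auto
  ultimately show ?thesis by simp
qed

lemma block_rank_eq_iff:
  assumes "i \<in> {1..n}" "k \<in> {1..n}"
  shows "block_rank n \<beta> i = block_rank n \<beta> k \<longleftrightarrow> i = k"
  using block_rank_le_iff[OF assms, of \<beta>] block_rank_le_iff[OF assms(2,1), of \<beta>]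
  by auto

lemma bij_betw_block_rank: "bij_betw (block_rank n \<beta>) {1..n} {1..n}"
proof -
  have "inj_on (block_rank n \<beta>) {1..n}"
    by (rule inj_onI) (simp only: block_rank_eq_iff)
  moreover have "block_rank n \<beta> ` {1..n} \<subseteq> {1..n}"
    using block_rank_in by blast
  ultimately show ?thesis by (simp add: bij_betw_def endo_inj_surj)
qed

text \<open>Take for \<open>j\<close> the predecessor of \<open>i\<close> in its block: the cars
  counted for \<open>i\<close> are those counted for \<open>j\<close>, together with
  \<open>i\<close>.\<close>

lemma block_rank_pred:
  assumes "i \<in> {1..n}" "\<exists>k\<in>{1..<i}. \<beta> k = \<beta> i"
  shows "\<exists>j\<in>{1..<i}. \<beta> j = \<beta> i \<and> block_rank n \<beta> i = Suc (block_rank n \<beta> j)"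
proof -
  define j where "j = Max {k \<in> {1..<i}. \<beta> k = \<beta> i}"
  have "j \<in> {k \<in> {1..<i}. \<beta> k = \<beta> i}"
    unfolding j_def using assms(2) by (intro Max_in) auto
  then have j: "j \<in> {1..<i}" "\<beta> j = \<beta> i" by auto
  have max: "k \<le> j" if "k \<in> {1..<i}" "\<beta> k = \<beta> i" for k
    unfolding j_def using that by (intro Max_ge) auto
  have "k \<le> i \<longleftrightarrow> k = i \<or> k \<le> j" if "k \<in> {1..n}" "\<beta> k = \<beta> i" for k
    using max[of k] that j(1) by (cases "k < i") auto
  then have "{k \<in> {1..n}. \<beta> k < \<beta> i \<or> \<beta> k = \<beta> i \<and> k \<le> i}
      = insert i {k \<in> {1..n}. \<beta> k < \<beta> j \<or> \<beta> k = \<beta> j \<and> k \<le> j}"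
    using assms(1) j(2) by auto
  then have "block_rank n \<beta> i = Suc (block_rank n \<beta> j)"
    unfolding block_rank_def using j by simp
  then show ?thesis using j by blast
qed

text \<open>A car that is not first in its block prefers the spot of its predecessor in the block,
  which is a smaller car and so parks earlier.\<close>

lemma unit_parking_preference: "unit_parking n (preference n \<beta>) (block_rank n \<beta>)"
proof
  show "bij_betw (block_rank n \<beta>) {1..n} {1..n}" by (rule bij_betw_block_rank)
  fix i assume i: "i \<in> {1..n}"
  have "1 \<le> preference n \<beta> i \<and> (block_rank n \<beta> i = preference n \<beta> i \<or>
    block_rank n \<beta> i = Suc (preference n \<beta> i) \<and> (\<exists>j\<in>{1..<i}. block_rank n \<beta> j = preference n \<beta> i))"
  proof (cases "\<exists>k\<in>{1..<i}. \<beta> k = \<beta> i")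
    case True
    then obtain j where j: "j \<in> {1..<i}" "block_rank n \<beta> i = Suc (block_rank n \<beta> j)"
      using block_rank_pred[OF i] by blast
    moreover have "preference n \<beta> i = block_rank n \<beta> j"
      using True j(2) by (simp add: preference_def)
    moreover have "block_rank n \<beta> j \<in> {1..n}" using j(1) i by (intro block_rank_in) auto
    ultimately show ?thesis by auto
  next
    case False
    then have "preference n \<beta> i = block_rank n \<beta> i" by (simp add: preference_def)
    then show ?thesis using block_rank_in[OF i, of \<beta>] by simp
  qed
  then show "1 \<le> preference n \<beta> i"
    and "block_rank n \<beta> i = preference n \<beta> i \<or> block_rank n \<beta> i = Suc (preference n \<beta> i) \<and>
      (\<exists>j\<in>{1..<i}. block_rank n \<beta> j = preference n \<beta> i)"
    by blast+
qed

lemma lucky_preference: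
  "unit_parking.lucky n (preference n \<beta>) (block_rank n \<beta>) = {i \<in> {1..n}. \<forall>k\<in>{1..<i}. \<beta> k \<noteq> \<beta> i}"
proof -
  interpret unit_parking n "preference n \<beta>" "block_rank n \<beta>" by (rule unit_parking_preference)
  have "block_rank n \<beta> i \<noteq> block_rank n \<beta> i - 1" if "i \<in> {1..n}" for i
    using block_rank_in[OF that, of \<beta>] by auto
  then show ?thesis unfolding lucky_def preference_def by auto
qed

text \<open>Each fibre of \<beta> over \<open>{1..m}\<close> is nonempty and has one least
  element.\<close>

lemma bij_betw_first_in_block:
  assumes "\<beta> ` {1..n} = {1..m}"
  shows "bij_betw \<beta> {i \<in> {1..n::nat}. \<forall>k\<in>{1..<i}. \<beta> k \<noteq> \<beta> i} {1..m::nat}"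
proof -
  let ?L = "{i \<in> {1..n::nat}. \<forall>k\<in>{1..<i}. \<beta> k \<noteq> \<beta> i}"
  have "inj_on \<beta> ?L"
  proof (rule inj_onI)
    fix i k assume "i \<in> ?L" "k \<in> ?L" "\<beta> i = \<beta> k"
    then show "i = k" by (cases i k rule: linorder_cases) force+
  qed
  moreover have "\<beta> ` ?L = {1..m}"
  proof
    show "\<beta> ` ?L \<subseteq> {1..m}" using assms by auto
    show "{1..m} \<subseteq> \<beta> ` ?L"
    proof
      fix j assume "j \<in> {1..m}"
      then have ex: "\<exists>i. i \<in> {1..n} \<and> \<beta> i = j" using assms by (metis imageE)
      define i where "i = (LEAST i. i \<in> {1..n} \<and> \<beta> i = j)"
      have i: "i \<in> {1..n} \<and> \<beta> i = j" unfolding i_def using ex by (rule LeastI_ex)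
      have "\<beta> k \<noteq> j" if "k \<in> {1..<i}" for k
        using not_less_Least[of k "\<lambda>i. i \<in> {1..n} \<and> \<beta> i = j"] that i unfolding i_def[symmetric] by auto
      then show "j \<in> \<beta> ` ?L" using i by blast
    qed
  qed
  ultimately show ?thesis by (simp add: bij_betw_def)
qed

text \<open>The construction returns the given \<beta>: lucky cars are the first in their blocks, so
  those in spots up to that of \<open>i\<close> correspond under \<beta> to the values in
  \<open>{1..\<beta> i}\<close>.\<close>

lemma block_preference:
  assumes "\<beta> ` {1..n} = {1..m}" "i \<in> {1..n}"
  shows "unit_parking.block n (preference n \<beta>) (block_rank n \<beta>) i = \<beta> i"
proof -
  interpret unit_parking n "preference n \<beta>" "block_rank n \<beta>" by (rule unit_parking_preference)
  note first = bij_betw_first_in_block[OF assms(1), folded lucky_preference]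
  have "block_rank n \<beta> k \<le> block_rank n \<beta> i \<longleftrightarrow> \<beta> k \<le> \<beta> i" if "k \<in> lucky" for k
  proof -
    have k: "k \<in> {1..n}" "\<forall>j\<in>{1..<k}. \<beta> j \<noteq> \<beta> k" using that by (auto simp: lucky_preference)
    have "k \<le> i" if "\<beta> k = \<beta> i"
    proof (rule ccontr)
      assume "\<not> k \<le> i"
      then have "i \<in> {1..<k}" using assms(2) by auto
      then show False using k(2) that by auto
    qed
    then show ?thesis using block_rank_le_iff[OF k(1) assms(2), of \<beta>] by auto
  qed
  then have "block i = card {k \<in> lucky. \<beta> k \<le> \<beta> i}"
    unfolding block_def by (intro arg_cong[where f = card]) auto
  also have "\<dots> = card (\<beta> ` {k \<in> lucky. \<beta> k \<le> \<beta> i})"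
    by (rule card_image[symmetric], rule inj_on_subset[OF bij_betw_imp_inj_on[OF first]]) auto
  also have "\<beta> ` {k \<in> lucky. \<beta> k \<le> \<beta> i} = {j \<in> \<beta> ` lucky. j \<le> \<beta> i}" by auto
  also have "\<dots> = {j \<in> {1..m}. j \<le> \<beta> i}" using first by (simp add: bij_betw_def)
  also have "\<dots> = {1..\<beta> i}"
  proof -
    have "\<beta> i \<le> m" using assms by auto
    then show ?thesis by auto
  qed
  finally show ?thesis by simp
qed

text \<open>Transfers the facts about \<open>preference n \<beta>\<close> to the entries of a list,
  which represent it for cars in \<open>{1..n}\<close>.\<close>

lemma unit_parking_cong:
  assumes "unit_parking n a s" "\<And>i. i \<in> {1..n} \<Longrightarrow> a i = a' i"
  shows "unit_parking n a' s"
    and "unit_parking.lucky n a s = unit_parking.lucky n a' s"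
    and "unit_parking.block n a s i = unit_parking.block n a' s i"
proof -
  show *: "unit_parking n a' s"
    using assms unfolding unit_parking_def by (auto 0 3)
  show lucky: "unit_parking.lucky n a s = unit_parking.lucky n a' s"
    unfolding unit_parking.lucky_def[OF *] unit_parking.lucky_def[OF assms(1)]
    using assms(2) by auto
  show "unit_parking.block n a s i = unit_parking.block n a' s i"
    unfolding unit_parking.block_def[OF *] unit_parking.block_def[OF assms(1)] lucky ..
qed

section \<open>The bijection with ordered set partitions\<close>

text \<open>Turns a surjection onto \<open>{1..m}\<close> into an ordered set partition; list
  position \<open>j\<close> holds the fibre over \<open>Suc j\<close>.\<close>

definition fibres :: "nat \<Rightarrow> nat \<Rightarrow> (nat \<Rightarrow> nat) \<Rightarrow> nat set list" where
  "fibres n m \<beta> = map (\<lambda>j. {i \<in> {1..n}. \<beta> i = j}) [1..<m + 1]"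

text \<open>The block index is a surjection that encodes the block partition and from which the
  tuple is recovered.\<close>

lemma UPF_block_partition:
  assumes "\<alpha> \<in> UPF n"
  shows "block_index \<alpha> ` {1..n} = {1..num_blocks \<alpha>}"
    and "block_partition \<alpha> = fibres n (num_blocks \<alpha>) (block_index \<alpha>)"
    and "\<alpha> = map (preference n (block_index \<alpha>)) [1..<n + 1]"
proof -
  obtain s where len: "length \<alpha> = n" and s: "unit_parking n (\<lambda>i. \<alpha> ! (i - 1)) s"
    using assms by (auto simp: UPF_iff)
  interpret unit_parking n "\<lambda>i. \<alpha> ! (i - 1)" s by (rule s)
  have bi: "block_index \<alpha> i = block i" if "i \<in> {1..n}" for i
    using block_index_eq[OF len s that] .
  then show "block_index \<alpha> ` {1..n} = {1..num_blocks \<alpha>}"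
    using image_block num_blocks_eq_card_lucky[OF len s] by simp
  have "\<forall>x\<in>set \<alpha>. x \<le> length \<alpha>"
    using assms by (auto simp: UPF_def parking_functions_def)
  then show "block_partition \<alpha> = fibres n (num_blocks \<alpha>) (block_index \<alpha>)"
    unfolding block_partition_def fibres_def
    using car_set_eq len by (intro map_cong) auto
  show "\<alpha> = map (preference n (block_index \<alpha>)) [1..<n + 1]"
  proof (rule nth_equalityI)
    show "length \<alpha> = length (map (preference n (block_index \<alpha>)) [1..<n + 1])" using len by simp
    fix i assume "i < length \<alpha>"
    then have i: "Suc i \<in> {1..n}" using len by simp
    \<comment> \<open>\<open>block_index\<close> and \<open>block\<close> are known to agree on
      \<open>{1..n}\<close>, where the rank evaluates them.\<close>
    have rank: "block_rank n (block_index \<alpha>) (Suc i) = block_rank n block (Suc i)"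
      unfolding block_rank_def using bi i by (intro arg_cong[where f = card]) auto
    have "(\<exists>k\<in>{1..<Suc i}. block_index \<alpha> k = block_index \<alpha> (Suc i))
      \<longleftrightarrow> (\<exists>k\<in>{1..<Suc i}. block k = block (Suc i))"
      using bi i by (intro bex_cong) auto
    then have "preference n (block_index \<alpha>) (Suc i) = preference n block (Suc i)"
      unfolding preference_def rank by simp
    then show "\<alpha> ! i = map (preference n (block_index \<alpha>)) [1..<n + 1] ! i"
      using preference_eq[OF i] i by (simp del: upt_Suc)
  qed
qed

text \<open>The converse construction, giving surjectivity of the block partition.\<close>

lemma UPF_of_block_index:
  assumes "\<beta> ` {1..n} = {1..m}"
  defines "\<alpha> \<equiv> map (preference n \<beta>) [1..<n + 1]"
  shows "\<alpha> \<in> UPF n" "num_blocks \<alpha> = m" "\<And>i. i \<in> {1..n} \<Longrightarrow> block_index \<alpha> i = \<beta> i"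
proof -
  have len: "length \<alpha> = n" by (simp add: \<alpha>_def)
  have nth: "preference n \<beta> i = \<alpha> ! (i - 1)" if "i \<in> {1..n}" for i
    using that by (auto simp: \<alpha>_def simp del: upt_Suc)
  note p = unit_parking_preference[of n \<beta>]
  note cong = unit_parking_cong[OF p, of "\<lambda>i. \<alpha> ! (i - 1)", OF nth]
  have u: "unit_parking n (\<lambda>i. \<alpha> ! (i - 1)) (block_rank n \<beta>)"
    by (rule cong(1))
  then show "\<alpha> \<in> UPF n" using len by (auto simp: UPF_iff)
  show "num_blocks \<alpha> = m"
    using num_blocks_eq_card_lucky[OF len u] cong(2)
      bij_betw_same_card[OF bij_betw_first_in_block[OF assms(1)]]
    by (simp add: lucky_preference)
  show "block_index \<alpha> i = \<beta> i" if "i \<in> {1..n}" for i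
    using block_index_eq[OF len u that] cong(3)[of i] block_preference[OF assms(1) that]
    by simp
qed

lemma length_fibres: "length (fibres n m \<beta>) = m"
  by (simp add: fibres_def)

lemma nth_fibres: "j < m \<Longrightarrow> fibres n m \<beta> ! j = {i \<in> {1..n}. \<beta> i = Suc j}"
  by (simp add: fibres_def del: upt_Suc)

lemma fibres_eqD:
  assumes "fibres n m \<beta> = fibres n m \<gamma>" "\<beta> ` {1..n} = {1..m}" "i \<in> {1..n}"
  shows "\<beta> i = \<gamma> i"
proof -
  have "\<beta> i \<in> {1..m}" using assms(2,3) by blast
  then have "\<beta> i - 1 < m" "Suc (\<beta> i - 1) = \<beta> i" by auto
  then have "i \<in> fibres n m \<beta> ! (\<beta> i - 1)" using assms(3) by (simp add: nth_fibres)
  then show ?thesis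
    unfolding assms(1) using \<open>\<beta> i - 1 < m\<close> \<open>Suc (\<beta> i - 1) = \<beta> i\<close> by (simp add: nth_fibres)
qed

text \<open>Surjectivity makes the fibres nonempty, hence, being disjoint, also distinct.\<close>

lemma fibres_in_ordered_partitions:
  assumes "\<beta> ` {1..n} = {1..m}"
  shows "fibres n m \<beta> \<in> ordered_partitions {1..n}"
proof -
  have ne: "{i \<in> {1..n}. \<beta> i = j} \<noteq> {}" if "j \<in> {1..m}" for j
  proof -
    have "j \<in> \<beta> ` {1..n}" using assms that by simp
    then show ?thesis by force
  qed
  have set: "set (fibres n m \<beta>) = (\<lambda>j. {i \<in> {1..n}. \<beta> i = j}) ` {1..m}"
    by (simp add: fibres_def atLeastLessThanSuc_atLeastAtMost del: upt_Suc)
  have "inj_on (\<lambda>j. {i \<in> {1..n}. \<beta> i = j}) {1..m}"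
    using ne by (intro inj_onI) blast
  then have "distinct (fibres n m \<beta>)"
    by (simp add: fibres_def distinct_map atLeastLessThanSuc_atLeastAtMost del: upt_Suc)
  moreover have "partition_on {1..n} (set (fibres n m \<beta>))"
    unfolding set
  proof (rule partition_onI)
    show "\<Union>((\<lambda>j. {i \<in> {1..n}. \<beta> i = j}) ` {1..m}) = {1..n}" using assms by blast
    show "{} \<notin> (\<lambda>j. {i \<in> {1..n}. \<beta> i = j}) ` {1..m}" using ne by blast
  qed (auto simp: disjnt_def)
  ultimately show ?thesis by (simp add: ordered_partitions_def)
qed

lemma ordered_partition_eq_fibres:
  assumes "Cs \<in> ordered_partitions {1..n}" "length Cs = m"
  obtains \<beta> where "\<beta> ` {1..n} = {1..m}" "fibres n m \<beta> = Cs"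
proof -
  have dist: "distinct Cs" and part: "partition_on {1..n} (set Cs)"
    using assms(1) by (auto simp: ordered_partitions_def)
  have "\<exists>j<m. i \<in> Cs ! j" if "i \<in> {1..n}" for i
    using that partition_onD1[OF part] assms(2) by (metis UnionE in_set_conv_nth)
  \<comment> \<open>\<open>f i\<close> is the position, from 0, of the block containing
    \<open>i\<close>; the required surjection is its successor.\<close>
  then obtain f where f: "\<And>i. i \<in> {1..n} \<Longrightarrow> f i < m \<and> i \<in> Cs ! f i" by metis
  have sub: "Cs ! j \<subseteq> {1..n}" if "j < m" for j
    using that partition_onD1[OF part] assms(2) by auto
  have uniq: "f i = j" if "i \<in> Cs ! j" "j < m" for i j
  proof -
    have i: "f i < m" "i \<in> Cs ! f i" using f sub that by blast+
    then have "Cs ! f i = Cs ! j"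
      using partition_onD2[OF part] that assms(2) unfolding disjoint_def
      by (metis IntI emptyE nth_mem)
    then show ?thesis using dist i(1) that(2) assms(2) by (simp add: nth_eq_iff_index_eq)
  qed
  show ?thesis
  proof (rule that[of "\<lambda>i. Suc (f i)"])
    show "fibres n m (\<lambda>i. Suc (f i)) = Cs"
    proof (rule nth_equalityI)
      fix j assume "j < length (fibres n m (\<lambda>i. Suc (f i)))"
      then have "j < m" by (simp add: length_fibres)
      then show "fibres n m (\<lambda>i. Suc (f i)) ! j = Cs ! j"
        using f uniq sub[OF \<open>j < m\<close>] by (auto simp: nth_fibres)
    qed (simp add: length_fibres assms(2))
    show "(\<lambda>i. Suc (f i)) ` {1..n} = {1..m}"
    proof
      show "(\<lambda>i. Suc (f i)) ` {1..n} \<subseteq> {1..m}" using f by (auto simp: Suc_le_eq)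
      show "{1..m} \<subseteq> (\<lambda>i. Suc (f i)) ` {1..n}"
      proof
        fix j assume j: "j \<in> {1..m}"
        then have "j - 1 < m" by auto
        then have "Cs ! (j - 1) \<noteq> {}" using partition_onD3[OF part] assms(2) by (metis nth_mem)
        then obtain i where "i \<in> Cs ! (j - 1)" by blast
        then show "j \<in> (\<lambda>i. Suc (f i)) ` {1..n}"
          using uniq[OF _ \<open>j - 1 < m\<close>] sub[OF \<open>j - 1 < m\<close>] j by (intro image_eqI[of _ _ i]) auto
      qed
    qed
  qed
qed

text \<open>Equal partitions have equal block indices on \<open>{1..n}\<close>, hence equal
  preferences. Conversely, an ordered partition is the list of fibres of a surjection, which
  \<open>UPF_of_block_index\<close> realizes.\<close>

lemma bij_betw_block_partition:
  "bij_betw block_partition {\<alpha> \<in> UPF n. num_blocks \<alpha> = m}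
    {Cs \<in> ordered_partitions {1..n}. length Cs = m}"
  unfolding bij_betw_def
proof
  show "inj_on block_partition {\<alpha> \<in> UPF n. num_blocks \<alpha> = m}"
  proof (rule inj_onI, clarify)
    fix \<alpha> \<gamma> assume \<alpha>: "\<alpha> \<in> UPF n" and \<gamma>: "\<gamma> \<in> UPF n" "num_blocks \<gamma> = num_blocks \<alpha>"
      and eq: "block_partition \<alpha> = block_partition \<gamma>"
    have *: "block_index \<alpha> i = block_index \<gamma> i" if "i \<in> {1..n}" for i
      using fibres_eqD[OF _ UPF_block_partition(1)[OF \<alpha>] that]
        eq UPF_block_partition(2)[OF \<alpha>] UPF_block_partition(2)[OF \<gamma>(1)] \<gamma>(2) by metis
    have "preference n (block_index \<alpha>) i = preference n (block_index \<gamma>) i" if i: "i \<in> {1..n}" for i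
    proof -
      have "block_rank n (block_index \<alpha>) i = block_rank n (block_index \<gamma>) i"
        unfolding block_rank_def using * i by (intro arg_cong[where f = card]) auto
      moreover have "(\<exists>k\<in>{1..<i}. block_index \<alpha> k = block_index \<alpha> i)
          \<longleftrightarrow> (\<exists>k\<in>{1..<i}. block_index \<gamma> k = block_index \<gamma> i)"
        using * i by (intro bex_cong) auto
      ultimately show ?thesis unfolding preference_def by simp
    qed
    then have "map (preference n (block_index \<alpha>)) [1..<n + 1] = map (preference n (block_index \<gamma>)) [1..<n + 1]"
      by (intro map_cong) auto
    then show "\<alpha> = \<gamma>" using UPF_block_partition(3)[OF \<alpha>] UPF_block_partition(3)[OF \<gamma>(1)] by metis
  qed
  show "block_partition ` {\<alpha> \<in> UPF n. num_blocks \<alpha> = m} = {Cs \<in> ordered_partitions {1..n}. length Cs = m}"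
  proof (intro equalityI subsetI)
    fix Cs assume "Cs \<in> block_partition ` {\<alpha> \<in> UPF n. num_blocks \<alpha> = m}"
    then obtain \<alpha> where "\<alpha> \<in> UPF n" "num_blocks \<alpha> = m" "Cs = block_partition \<alpha>" by blast
    then show "Cs \<in> {Cs \<in> ordered_partitions {1..n}. length Cs = m}"
      using UPF_block_partition(1,2)[of \<alpha> n] fibres_in_ordered_partitions length_fibres by simp
  next
    fix Cs assume "Cs \<in> {Cs \<in> ordered_partitions {1..n}. length Cs = m}"
    then obtain \<beta> where \<beta>: "\<beta> ` {1..n} = {1..m}" "fibres n m \<beta> = Cs"
      using ordered_partition_eq_fibres by blast
    define \<alpha> where "\<alpha> = map (preference n \<beta>) [1..<n + 1]"
    note \<alpha> = UPF_of_block_index[OF \<beta>(1), folded \<alpha>_def]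
    have "fibres n m (block_index \<alpha>) = fibres n m \<beta>"
      unfolding fibres_def using \<alpha>(3) by (intro map_cong) auto
    then have "block_partition \<alpha> = Cs" using UPF_block_partition(2)[OF \<alpha>(1)] \<alpha>(2) \<beta>(2) by simp
    then show "Cs \<in> block_partition ` {\<alpha> \<in> UPF n. num_blocks \<alpha> = m}" using \<alpha>(1,2) by blast
  qed
qed

theorem theorem4p3:
  fixes n m r :: nat
  assumes "r \<le> m" and "m \<le> n"
  shows "card {\<alpha> \<in> UPF n. num_blocks \<alpha> = m \<and> fix_blocks \<alpha> = r}
    = Stirling n m * (m choose r) * derangements (m - r)"
proof -
  note bij = bij_betw_block_partition[of n m]
  \<comment> \<open>\<open>fix_blocks\<close> depends only on the block partition, so the bijection
    restricts to the tuples with \<open>r\<close> fixed blocks.\<close>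
  have "block_partition ` {\<alpha> \<in> UPF n. num_blocks \<alpha> = m \<and> fix_blocks \<alpha> = r}
      = {Cs \<in> block_partition ` {\<alpha> \<in> UPF n. num_blocks \<alpha> = m}. num_fixed_blocks Cs = r}"
    by (auto simp: fix_blocks_def)
  also have "\<dots> = {Cs \<in> ordered_partitions {1..n}. length Cs = m \<and> num_fixed_blocks Cs = r}"
    unfolding bij_betw_imp_surj_on[OF bij] by auto
  finally have image: "block_partition ` {\<alpha> \<in> UPF n. num_blocks \<alpha> = m \<and> fix_blocks \<alpha> = r} = \<dots>" .
  have "inj_on block_partition {\<alpha> \<in> UPF n. num_blocks \<alpha> = m \<and> fix_blocks \<alpha> = r}"
    by (rule inj_on_subset[OF bij_betw_imp_inj_on[OF bij]]) auto
  from card_image[OF this]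
  have "card {\<alpha> \<in> UPF n. num_blocks \<alpha> = m \<and> fix_blocks \<alpha> = r}
      = card {Cs \<in> ordered_partitions {1..n}. length Cs = m \<and> num_fixed_blocks Cs = r}"
    unfolding image by simp
  then show ?thesis using card_ordered_partitions_fixed[of "{1..n}" m r] by simp
qed

end
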